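(* Let $X,Y$ be finite nonempty sets. For every (total or partial) Boolean function $f:X\times Y\rightarrow\{0,1\}$, $$Q(f)=\left\lceil \frac{C(f)}{2}\right\rceil ,$$ where $Q(f)$ and $C(f)$ are the unbounded-error one-way quantum and classical communication complexities of $f$.
   Context: A partial Boolean function $f:X\times Y\to\{0,1\}$ is defined only on a subset $\mathrm{dom}(f)\subseteq X\times Y$; it is total if $\mathrm{dom}(f)=X\times Y$. Alice holds $x\in X$, Bob holds $y\in Y$, only Alice sends a message to Bob, and there is no shared randomness or entanglement. One-way quantum protocol with cost $n$ (an integer $n\ge 0$) for $f$: for each $x\in X$ an $n$-qubit state $\rho_x$ (a $2^n\times 2^n$ positive semidefinite complex matrix of trace $1$) and for each $y\in Y$ a two-outcome POVM $\{E_y,I-E_y\}$ on $n$ qubits ($E_y$ and $I-E_y$ positive semidefinite). Bob outputs $0$ with probability $\mathrm{Tr}(E_y\rho_x)$ and $1$ otherwise. One-way classical protocol with cost $n$ for $f$: for each $x\in X$ a probability distribution $q_x$ on $\{0,1\}^n$ (Alice's message), and for each $y\in Y$ and message $s\in\{0,1\}^n$ a number $l_y(s)\in[0,1]$, the probability that Bob outputs $0$ on receiving $s$. Bob outputs $0$ with probability $\sum_s q_x(s)l_y(s)$ and $1$ otherwise. Unbounded-error: the protocol computes $f$ if for every $(x,y)\in\mathrm{dom}(f)$ Bob outputs $f(x,y)$ with probability strictly larger than $1/2$. $Q(f)$ (resp. $C(f)$) is the minimum cost $n$ of a one-way quantum (resp. classical) protocol computing $f$ in this sense. *)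

theory Defs
  imports Complex_Main "Jordan_Normal_Form.Matrix"
begin

(* A partial Boolean function on X \<times> Y is a map f :: 'a \<times> 'b \<Rightarrow> bool option with
   dom f \<subseteq> X \<times> Y; the output values 0 and 1 are False and True. *)

(* p x y is the probability that Bob outputs 0 on input (x, y). *)
definition computes_unbounded_error ::
  "('a \<times> 'b \<Rightarrow> bool option) \<Rightarrow> ('a \<Rightarrow> 'b \<Rightarrow> real) \<Rightarrow> bool" where
  "computes_unbounded_error f p \<longleftrightarrow>
     (\<forall>x y b. f (x, y) = Some b \<longrightarrow> (if b then 1 - p x y else p x y) > 1 / 2)"


definition mat_trace :: "complex mat \<Rightarrow> complex" where
  "mat_trace A = (\<Sum>i<dim_row A. A $$ (i, i))"

(* The order on complex numbers is that of HOL-Library.Complex_Order: 0 \<le> z means that z is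
   real and nonnegative, so a positive semidefinite matrix is in particular Hermitian. *)
definition psd_mat :: "nat \<Rightarrow> complex mat \<Rightarrow> bool" where
  "psd_mat d A \<longleftrightarrow>
     A \<in> carrier_mat d d \<and> (\<forall>v \<in> carrier_vec d. 0 \<le> (A *\<^sub>v v) \<bullet>c v)"

definition qubit_state :: "nat \<Rightarrow> complex mat \<Rightarrow> bool" where
  "qubit_state n \<rho> \<longleftrightarrow> psd_mat (2 ^ n) \<rho> \<and> mat_trace \<rho> = 1"

(* The two-outcome POVM {E, I - E} on n qubits is represented by E. *)
definition qubit_povm :: "nat \<Rightarrow> complex mat \<Rightarrow> bool" where
  "qubit_povm n E \<longleftrightarrow> psd_mat (2 ^ n) E \<and> psd_mat (2 ^ n) (1\<^sub>m (2 ^ n) - E)"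

definition quantum_protocol ::
  "nat \<Rightarrow> 'a set \<Rightarrow> 'b set \<Rightarrow> ('a \<Rightarrow> complex mat) \<Rightarrow> ('b \<Rightarrow> complex mat) \<Rightarrow> bool" where
  "quantum_protocol n X Y \<rho> E \<longleftrightarrow>
     (\<forall>x\<in>X. qubit_state n (\<rho> x)) \<and> (\<forall>y\<in>Y. qubit_povm n (E y))"

(* The trace is real for a state and a POVM element, so taking the real part is only a coercion. *)
definition quantum_prob0 ::
  "('a \<Rightarrow> complex mat) \<Rightarrow> ('b \<Rightarrow> complex mat) \<Rightarrow> 'a \<Rightarrow> 'b \<Rightarrow> real" where
  "quantum_prob0 \<rho> E x y = Re (mat_trace (E y * \<rho> x))"


definition messages :: "nat \<Rightarrow> bool list set" where
  "messages n = {s. length s = n}"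

definition classical_protocol ::
  "nat \<Rightarrow> 'a set \<Rightarrow> 'b set \<Rightarrow> ('a \<Rightarrow> bool list \<Rightarrow> real) \<Rightarrow> ('b \<Rightarrow> bool list \<Rightarrow> real) \<Rightarrow> bool" where
  "classical_protocol n X Y q l \<longleftrightarrow>
     (\<forall>x\<in>X. (\<forall>s\<in>messages n. 0 \<le> q x s) \<and> (\<Sum>s\<in>messages n. q x s) = 1) \<and>
     (\<forall>y\<in>Y. \<forall>s\<in>messages n. 0 \<le> l y s \<and> l y s \<le> 1)"

definition classical_prob0 ::
  "nat \<Rightarrow> ('a \<Rightarrow> bool list \<Rightarrow> real) \<Rightarrow> ('b \<Rightarrow> bool list \<Rightarrow> real) \<Rightarrow> 'a \<Rightarrow> 'b \<Rightarrow> real" where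
  "classical_prob0 n q l x y = (\<Sum>s\<in>messages n. q x s * l y s)"


(* For finite X and Y both minima below are attained: sending x itself with enough (qu)bits
   computes f. *)
definition quantum_complexity :: "'a set \<Rightarrow> 'b set \<Rightarrow> ('a \<times> 'b \<Rightarrow> bool option) \<Rightarrow> nat" where
  "quantum_complexity X Y f =
     (LEAST n. \<exists>\<rho> E. quantum_protocol n X Y \<rho> E \<and>
                     computes_unbounded_error f (quantum_prob0 \<rho> E))"

definition classical_complexity :: "'a set \<Rightarrow> 'b set \<Rightarrow> ('a \<times> 'b \<Rightarrow> bool option) \<Rightarrow> nat" where
  "classical_complexity X Y f =
     (LEAST n. \<exists>q l. classical_protocol n X Y q l \<and>
                     computes_unbounded_error f (classical_prob0 n q l))"

end

theory Submission
  imports Defs "HOL-Analysis.Convex"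
begin

text \<open>
  Both kinds of protocol are the same linear-algebraic object: for each \<open>x\<close> a vector on an affine
  hyperplane of a real space and for each \<open>y\<close> a linear functional whose sign on that vector is
  prescribed by \<open>f\<close>. Contracting the vectors towards a centre and rescaling the functionals preserves
  the signs, so positivity constraints are for free, and only the dimension of the space matters.
  It is \<open>2 ^ n\<close> for probability vectors on \<open>n\<close> bits and \<open>4 ^ n\<close> for Hermitian matrices on \<open>n\<close> qubits,
  so \<open>n\<close> qubits are worth exactly \<open>2 * n\<close> bits.
\<close>

section \<open>Sign representations on affine hyperplanes\<close>

text \<open>The normal \<open>g\<close> is kept abstract so that total mass (\<open>g\<close>
  constantly 1) and trace (\<open>g = delta\<close>) are both covered. The offset 1/2 reduces
  correctness to the sign of the pairing; the value need not be a probability.\<close>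

definition sign_representation ::
  "'a set \<Rightarrow> ('a \<times> 'b \<Rightarrow> bool option) \<Rightarrow> 'i set \<Rightarrow> ('i \<Rightarrow> real) \<Rightarrow>
    ('a \<Rightarrow> 'i \<Rightarrow> real) \<Rightarrow> ('b \<Rightarrow> 'i \<Rightarrow> real) \<Rightarrow> bool" where
  "sign_representation X f I g p q \<longleftrightarrow>
     (\<forall>x\<in>X. (\<Sum>i\<in>I. p x i * g i) = 1) \<and>
     computes_unbounded_error f (\<lambda>x y. 1 / 2 + (\<Sum>i\<in>I. p x i * q y i))"

text \<open>Unbounded error sees only the sign of the bias, so biases may be rescaled by positive
  factors. \<open>dom f\<close> lies in \<open>X \<times> Y\<close>, so a comparison there
  suffices.\<close>

lemma computes_unbounded_error_sgn_cong:
  assumes "dom f \<subseteq> X \<times> Y" and "computes_unbounded_error f p"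
    and "\<And>x y. x \<in> X \<Longrightarrow> y \<in> Y \<Longrightarrow> sgn (p x y - 1 / 2) = sgn (p' x y - 1 / 2)"
  shows "computes_unbounded_error f p'"
  unfolding computes_unbounded_error_def
proof (intro allI impI)
  fix x y b assume fb: "f (x, y) = Some b"
  then have "x \<in> X" "y \<in> Y" using assms(1) by auto
  then have s: "sgn (p x y - 1 / 2) = sgn (p' x y - 1 / 2)" using assms(3) by blast
  have "(if b then 1 - p x y else p x y) > 1 / 2"
    using assms(2) fb unfolding computes_unbounded_error_def by blast
  then show "(if b then 1 - p' x y else p' x y) > 1 / 2"
    using s by (auto simp: sgn_if split: if_splits)
qed

text \<open>On the hyperplane of \<open>g\<close>, subtracting a multiple of \<open>g\<close> from a
  functional shifts it by a constant. This removes coordinate \<open>a\<close>; the remaining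
  coordinates embed into \<open>J - {b}\<close>, coordinate \<open>b\<close> restores the
  normalisation for \<open>h\<close>, and a multiple of \<open>h\<close> gives the constant
  back.\<close>

lemma sign_representation_mono:
  assumes rep: "sign_representation X f I g p q" and dom: "dom f \<subseteq> X \<times> Y"
    and fin: "finite I" "finite J" and card: "card I \<le> card J"
    and a: "a \<in> I" "g a \<noteq> 0" and b: "b \<in> J" "h b \<noteq> 0"
  shows "\<exists>p' q'. sign_representation X f J h p' q'"
proof -
  have "card (I - {a}) \<le> card (J - {b})" using card fin a b by simp
  then obtain \<phi> where inj: "inj_on \<phi> (I - {a})" and sub: "\<phi> ` (I - {a}) \<subseteq> J - {b}"
    using inj_on_iff_card_le[of "I - {a}" "J - {b}"] fin by auto
  define S where "S = \<phi> ` (I - {a})"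
  define \<psi> where "\<psi> = inv_into (I - {a}) \<phi>"
  have S: "S \<subseteq> J" "b \<notin> S" "finite S" using sub fin unfolding S_def by auto
  have reindex: "(\<Sum>j\<in>S. F (\<psi> j)) = (\<Sum>i\<in>I - {a}. F i)" for F :: "'c \<Rightarrow> real"
    unfolding S_def by (subst sum.reindex[OF inj]) (auto simp: \<psi>_def inv_into_f_f[OF inj])
  \<comment> \<open>The entry at \<open>b\<close> is solved from the equation of the new hyperplane;
    it may have any sign.\<close>
  define p' where "p' = (\<lambda>x j. if j \<in> S then p x (\<psi> j)
    else if j = b then (1 - (\<Sum>k\<in>S. p x (\<psi> k) * h k)) / h b else 0)"
  \<comment> \<open>With this factor \<open>q y i - l y * g i\<close> vanishes at
    \<open>i = a\<close>, so dropping \<open>a\<close> loses nothing.\<close>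
  define l where "l = (\<lambda>y. q y a / g a)"
  define q' where "q' = (\<lambda>y j. l y * h j + (if j \<in> S then q y (\<psi> j) - l y * g (\<psi> j) else 0))"
  have one: "(\<Sum>j\<in>J. p' x j * h j) = 1" for x
  proof -
    have "(\<Sum>j\<in>J. p' x j * h j) = (\<Sum>j\<in>insert b S. p' x j * h j)"
      by (rule sum.mono_neutral_right) (use fin S b in \<open>auto simp: p'_def\<close>)
    also have "\<dots> = p' x b * h b + (\<Sum>j\<in>S. p' x j * h j)"
      using S by simp
    also have "(\<Sum>j\<in>S. p' x j * h j) = (\<Sum>k\<in>S. p x (\<psi> k) * h k)"
      by (rule sum.cong) (auto simp: p'_def)
    also have "p' x b * h b = 1 - (\<Sum>k\<in>S. p x (\<psi> k) * h k)"
      using S b by (simp add: p'_def)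
    finally show ?thesis by simp
  qed
  have same: "(\<Sum>j\<in>J. p' x j * q' y j) = (\<Sum>i\<in>I. p x i * q y i)" if x: "x \<in> X" for x y
  proof -
    let ?r = "\<lambda>i. p x i * (q y i - l y * g i)"
    have "(\<Sum>j\<in>J. p' x j * q' y j)
        = (\<Sum>j\<in>J. l y * (p' x j * h j) + (if j \<in> S then ?r (\<psi> j) else 0))"
      by (rule sum.cong) (auto simp: q'_def p'_def algebra_simps)
    also have "\<dots> = l y + (\<Sum>j\<in>S. ?r (\<psi> j))"
      using S fin one[of x]
      by (simp add: sum.distrib sum.If_cases Int_absorb1 flip: sum_distrib_left)
    also have "(\<Sum>j\<in>S. ?r (\<psi> j)) = (\<Sum>i\<in>I - {a}. ?r i)" by (rule reindex)
    also have "\<dots> = (\<Sum>i\<in>I. ?r i)"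
      by (rule sum.mono_neutral_left) (use fin a in \<open>auto simp: l_def\<close>)
    also have "\<dots> = (\<Sum>i\<in>I. p x i * q y i) - l y * (\<Sum>i\<in>I. p x i * g i)"
      by (simp add: algebra_simps sum_subtractf sum_distrib_left)
    also have "(\<Sum>i\<in>I. p x i * g i) = 1"
      using rep x unfolding sign_representation_def by blast
    finally show ?thesis by simp
  qed
  have "computes_unbounded_error f (\<lambda>x y. 1 / 2 + (\<Sum>j\<in>J. p' x j * q' y j))"
    by (rule computes_unbounded_error_sgn_cong[OF dom])
      (use rep same in \<open>auto simp: sign_representation_def\<close>)
  then show ?thesis using one unfolding sign_representation_def by blast
qed

text \<open>Contracting towards a centre \<open>c\<close> on the hyperplane stays on it and changes
  each pairing affinely. The additive constant is cancelled by a multiple of \<open>g\<close>,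
  leaving a positive multiple of the old pairing; the functional can then be scaled down for each
  \<open>y\<close> separately.\<close>

lemma sign_representation_near:
  assumes rep: "sign_representation X f I g p q" and dom: "dom f \<subseteq> X \<times> Y"
    and fin: "finite X" "finite I" and c: "(\<Sum>i\<in>I. c i * g i) = 1" and e: "\<epsilon> > 0"
  obtains p' q' where "sign_representation X f I g p' q'"
    and "\<And>x i. x \<in> X \<Longrightarrow> i \<in> I \<Longrightarrow> \<bar>p' x i - c i\<bar> \<le> \<epsilon>"
    and "\<And>y i. i \<in> I \<Longrightarrow> \<bar>q' y i\<bar> \<le> \<epsilon>"
proof -
  \<comment> \<open>\<open>M\<close> bounds every deviation from the centre, so one contraction
    factor serves all of the finite \<open>X\<close>; the summand 1 keeps the divisor
    positive.\<close>
  define M where "M = 1 + (\<Sum>x\<in>X. \<Sum>i\<in>I. \<bar>p x i - c i\<bar>)"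
  define t where "t = \<epsilon> / M"
  have "M \<ge> 1" unfolding M_def by (simp add: sum_nonneg)
  then have t: "t > 0" using e by (simp add: t_def)
  define p' where "p' = (\<lambda>x i. c i + t * (p x i - c i))"
  \<comment> \<open>A contracted point pairs with \<open>q y\<close> to \<open>(1 - t)\<close> times
    the value at the centre plus \<open>t\<close> times the old value; the subtracted term removes
    the former.\<close>
  define r where "r = (\<lambda>y i. q y i - (1 - t) * (\<Sum>k\<in>I. c k * q y k) * g i)"
  define K where "K = (\<lambda>y. \<epsilon> / (1 + (\<Sum>i\<in>I. \<bar>r y i\<bar>)))"
  define q' where "q' = (\<lambda>y i. K y * r y i)"
  have pos: "1 + (\<Sum>i\<in>I. \<bar>r y i\<bar>) > 0" for y
    by (smt (verit) sum_nonneg abs_ge_zero)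
  have K: "K y > 0" for y using e pos unfolding K_def by simp
  have one: "(\<Sum>i\<in>I. p' x i * g i) = 1" if x: "x \<in> X" for x
  proof -
    have "(\<Sum>i\<in>I. p' x i * g i)
        = (1 - t) * (\<Sum>i\<in>I. c i * g i) + t * (\<Sum>i\<in>I. p x i * g i)"
      by (simp add: p'_def algebra_simps sum.distrib sum_subtractf sum_distrib_left)
    then show ?thesis using c rep x unfolding sign_representation_def by simp
  qed
  have val: "(\<Sum>i\<in>I. p' x i * q' y i) = K y * t * (\<Sum>i\<in>I. p x i * q y i)" if x: "x \<in> X" for x y
  proof -
    define s where "s = (\<Sum>k\<in>I. c k * q y k)"
    have r: "r y i = q y i - (1 - t) * s * g i" for i by (simp add: r_def s_def)
    have "(\<Sum>i\<in>I. p' x i * q' y i)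
        = K y * ((\<Sum>i\<in>I. p' x i * q y i) - (1 - t) * s * (\<Sum>i\<in>I. p' x i * g i))"
      by (simp add: q'_def r algebra_simps sum.distrib sum_subtractf
          sum_distrib_left)
    also have "(\<Sum>i\<in>I. p' x i * q y i) = (1 - t) * s + t * (\<Sum>i\<in>I. p x i * q y i)"
      by (simp add: p'_def s_def algebra_simps sum.distrib sum_subtractf sum_distrib_left)
    finally show ?thesis using one[OF x] by simp
  qed
  have rep': "sign_representation X f I g p' q'"
    unfolding sign_representation_def
  proof
    show "computes_unbounded_error f (\<lambda>x y. 1 / 2 + (\<Sum>i\<in>I. p' x i * q' y i))"
    proof (rule computes_unbounded_error_sgn_cong[OF dom])
      show "computes_unbounded_error f (\<lambda>x y. 1 / 2 + (\<Sum>i\<in>I. p x i * q y i))"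
        using rep unfolding sign_representation_def by blast
      show "sgn (1 / 2 + (\<Sum>i\<in>I. p x i * q y i) - 1 / 2)
          = sgn (1 / 2 + (\<Sum>i\<in>I. p' x i * q' y i) - 1 / 2)"
        if "x \<in> X" for x y
        using val[OF that, of y] K[of y] t by (simp add: sgn_mult)
    qed
  qed (use one in blast)
  have close: "\<bar>p' x i - c i\<bar> \<le> \<epsilon>" if "x \<in> X" "i \<in> I" for x i
  proof -
    have "\<bar>p x i - c i\<bar> \<le> (\<Sum>i\<in>I. \<bar>p x i - c i\<bar>)"
      using that fin by (intro member_le_sum) auto
    also have "\<dots> \<le> (\<Sum>x\<in>X. \<Sum>i\<in>I. \<bar>p x i - c i\<bar>)"
      using that fin by (intro member_le_sum) (auto simp: sum_nonneg)
    finally have "\<bar>p x i - c i\<bar> \<le> M" by (simp add: M_def)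
    then have "t * \<bar>p x i - c i\<bar> \<le> t * M" using t by simp
    also have "t * M = \<epsilon>" using \<open>M \<ge> 1\<close> by (simp add: t_def)
    finally show ?thesis using t by (simp add: p'_def abs_mult)
  qed
  have small: "\<bar>q' y i\<bar> \<le> \<epsilon>" if "i \<in> I" for y i
  proof -
    have "\<bar>r y i\<bar> \<le> 1 + (\<Sum>i\<in>I. \<bar>r y i\<bar>)"
      using member_le_sum[OF that, of "\<lambda>i. \<bar>r y i\<bar>"] fin by simp
    then have "K y * \<bar>r y i\<bar> \<le> K y * (1 + (\<Sum>i\<in>I. \<bar>r y i\<bar>))" using K[of y] by simp
    also have "\<dots> = \<epsilon>" using pos[of y] by (simp add: K_def)
    finally show ?thesis using K[of y] by (simp add: q'_def abs_mult)
  qed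
  show thesis using that rep' close small by blast
qed

text \<open>Alice sends \<open>x\<close> itself: each input has its own coordinate, from which the
  functional reads the sign. Inputs where \<open>f\<close> is undefined get the default sign +1.
  This provides a representation from which the minimum is known to exist.\<close>

lemma sign_representation_indicator:
  assumes "finite X" and "dom f \<subseteq> X \<times> Y"
  shows "sign_representation X f X (\<lambda>_. 1) (\<lambda>x i. if i = x then 1 else 0)
    (\<lambda>y i. if f (i, y) = Some True then - 1 else 1)"
proof -
  have "(\<Sum>i\<in>X. (if i = x then 1 else 0) * F i) = F x" if "x \<in> X" for x and F :: "'a \<Rightarrow> real"
    using assms(1) that by (simp add: if_distrib[of "\<lambda>a. a * _"] cong: if_cong)
  moreover have "x \<in> X" if "f (x, y) = Some b" for x y b using assms(2) that by auto
  ultimately show ?thesis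
    unfolding sign_representation_def computes_unbounded_error_def
    by (auto simp del: mult_1_right)
qed

section \<open>Classical protocols as sign representations\<close>

lemma finite_messages: "finite (messages n)"
  and card_messages: "card (messages n) = 2 ^ n"
  using finite_lists_length_eq[of "UNIV :: bool set" n] card_lists_length_eq[of "UNIV :: bool set" n]
  by (simp_all add: messages_def)

lemma messages_nonempty: "replicate n True \<in> messages n"
  by (simp add: messages_def)

text \<open>Since probabilities sum to 1, subtracting 1/2 from every \<open>l y s\<close> subtracts
  1/2 from Bob's probability. Conversely, a representation contracted towards the uniform
  distribution satisfies the positivity constraints.\<close>

lemma classical_protocol_iff_sign_representation:
  assumes dom: "dom f \<subseteq> X \<times> Y" and fin: "finite X"
  shows "(\<exists>q l. classical_protocol n X Y q l \<and> computes_unbounded_error f (classical_prob0 n q l))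
    \<longleftrightarrow> (\<exists>p q. sign_representation X f (messages n) (\<lambda>_. 1) p q)" (is "?C \<longleftrightarrow> ?R")
proof
  assume ?C
  then obtain q l where cp: "classical_protocol n X Y q l"
    and co: "computes_unbounded_error f (classical_prob0 n q l)" by blast
  have one: "(\<Sum>s\<in>messages n. q x s) = 1" if "x \<in> X" for x
    using cp that unfolding classical_protocol_def by blast
  have "computes_unbounded_error f (\<lambda>x y. 1 / 2 + (\<Sum>s\<in>messages n. q x s * (l y s - 1 / 2)))"
    by (rule computes_unbounded_error_sgn_cong[OF dom co])
      (use one in \<open>simp add: classical_prob0_def algebra_simps sum_subtractf
          flip: sum_divide_distrib\<close>)
  then have "sign_representation X f (messages n) (\<lambda>_. 1) q (\<lambda>y s. l y s - 1 / 2)"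
    using one unfolding sign_representation_def by simp
  then show ?R by blast
next
  assume ?R
  then obtain p0 q0 where "sign_representation X f (messages n) (\<lambda>_. 1) p0 q0" by blast
  \<comment> \<open>The radius is half a uniform weight, which keeps \<open>p\<close> nonnegative;
    it is at most 1/2, which keeps \<open>q y s + 1 / 2\<close> in the unit interval.\<close>
  then obtain p q where rep: "sign_representation X f (messages n) (\<lambda>_. 1) p q"
    and p: "\<And>x s. x \<in> X \<Longrightarrow> s \<in> messages n \<Longrightarrow> \<bar>p x s - 1 / 2 ^ n\<bar> \<le> 1 / (2 * 2 ^ n)"
    and q: "\<And>y s. s \<in> messages n \<Longrightarrow> \<bar>q y s\<bar> \<le> 1 / (2 * 2 ^ n)"
    by (rule sign_representation_near[where c = "\<lambda>_. 1 / 2 ^ n" and \<epsilon> = "1 / (2 * 2 ^ n)"])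
      (use dom fin in \<open>simp_all add: finite_messages card_messages\<close>)
  have one: "(\<Sum>s\<in>messages n. p x s) = 1" if "x \<in> X" for x
    using rep that unfolding sign_representation_def by simp
  have nonneg: "0 \<le> p x s" if "x \<in> X" "s \<in> messages n" for x s
  proof -
    have "(1::real) / (2 * 2 ^ n) \<le> 1 / 2 ^ n" by (simp add: field_simps)
    then show ?thesis using p[OF that] by linarith
  qed
  have half: "(1::real) / (2 * 2 ^ n) \<le> 1 / 2" by (simp add: field_simps)
  have bounds: "0 \<le> q y s + 1 / 2 \<and> q y s + 1 / 2 \<le> 1" if "s \<in> messages n" for y s
    using q[OF that, of y] half by linarith
  have "classical_protocol n X Y p (\<lambda>y s. q y s + 1 / 2)"
    unfolding classical_protocol_def using one nonneg bounds by blast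
  moreover have "computes_unbounded_error f (classical_prob0 n p (\<lambda>y s. q y s + 1 / 2))"
    by (rule computes_unbounded_error_sgn_cong[OF dom])
      (use rep one in \<open>auto simp: sign_representation_def classical_prob0_def algebra_simps
          sum.distrib simp flip: sum_divide_distrib\<close>)
  ultimately show ?C by blast
qed

section \<open>Positive semidefinite matrices\<close>

lemma cscalar_prod_mult_mat_vec:
  assumes "A \<in> carrier_mat d d" and "v \<in> carrier_vec d"
  shows "(A *\<^sub>v v) \<bullet>c v = (\<Sum>i<d. \<Sum>j<d. A $$ (i, j) * v $ j * cnj (v $ i))"
  using assms
  by (auto simp: scalar_prod_def sum_distrib_right lessThan_atLeast0 intro!: sum.cong)

text \<open>Polarisation: the quadratic form is real on all vectors, and vectors supported on one or
  two coordinates recover the entries.\<close>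

lemma psd_mat_hermitian:
  assumes psd: "psd_mat d A" and i: "i < d" and j: "j < d"
  shows "A $$ (i, j) = cnj (A $$ (j, i))"
proof -
  have A: "A \<in> carrier_mat d d" using psd by (simp add: psd_mat_def)
  have quad: "Im ((\<Sum>i<d. \<Sum>j<d. A $$ (i, j) * u j * cnj (u i))) = 0" for u
  proof -
    have "0 \<le> (A *\<^sub>v vec d u) \<bullet>c vec d u" using psd by (simp add: psd_mat_def)
    then show ?thesis
      using cscalar_prod_mult_mat_vec[OF A, of "vec d u"] by (simp add: less_eq_complex_def)
  qed
  have diag: "Im (A $$ (k, k)) = 0" if "k < d" for k
  proof -
    let ?u = "\<lambda>l. if l = k then 1 else 0"
    have "(\<Sum>i<d. \<Sum>j<d. A $$ (i, j) * ?u j * cnj (?u i))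
        = (\<Sum>i<d. if i = k then A $$ (k, k) else 0)"
      by (rule sum.cong) (use that in \<open>auto simp: if_distrib[of "\<lambda>a. _ * a"] cong: if_cong\<close>)
    also have "\<dots> = A $$ (k, k)" using that by simp
    finally show ?thesis using quad[of ?u] by simp
  qed
  show ?thesis
  proof (cases "i = j")
    case True
    then show ?thesis using diag[OF i] by (simp add: complex_eq_iff)
  next
    case False
    have two: "(\<Sum>k<d. F k) = F i + F j"
      if "\<And>k. k \<noteq> i \<Longrightarrow> k \<noteq> j \<Longrightarrow> F k = 0" for F :: "nat \<Rightarrow> complex"
    proof -
      have "(\<Sum>k<d. F k) = (\<Sum>k\<in>{i, j}. F k)"
        by (rule sum.mono_neutral_right) (use i j that in auto)
      then show ?thesis using False by simp
    qed
    have ab: "Im (A $$ (i, i) * a * cnj a + A $$ (i, j) * b * cnj a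
        + (A $$ (j, i) * a * cnj b + A $$ (j, j) * b * cnj b)) = 0" for a b
    proof -
      let ?u = "\<lambda>k. if k = i then a else if k = j then b else 0"
      have "(\<Sum>k<d. \<Sum>l<d. A $$ (k, l) * ?u l * cnj (?u k))
          = (\<Sum>k<d. A $$ (k, i) * ?u i * cnj (?u k) + A $$ (k, j) * ?u j * cnj (?u k))"
        by (intro sum.cong refl two) auto
      also have "\<dots> = A $$ (i, i) * a * cnj a + A $$ (i, j) * b * cnj a
        + (A $$ (j, i) * a * cnj b + A $$ (j, j) * b * cnj b)"
        by (subst two) (use False in auto)
      finally show ?thesis using quad[of ?u] by simp
    qed
    \<comment> \<open>The vector (1, 1) makes the imaginary parts of the two off-diagonal entries
      opposite; (1, \<i>) makes their real parts equal.\<close>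
    show ?thesis
      using ab[of 1 1] ab[of 1 \<i>] diag[OF i] diag[OF j] by (simp add: complex_eq_iff)
  qed
qed

text \<open>Write the matrix as \<open>c\<close> times the identity plus \<open>H\<close>. The
  entrywise bound \<open>c / d\<close> makes the quadratic form of \<open>H\<close> at most
  \<open>c\<close> times the squared norm, so it cannot outweigh the scalar part.\<close>

lemma psd_mat_near_scalar:
  assumes A: "A \<in> carrier_mat d d"
    and herm: "\<And>i j. i < d \<Longrightarrow> j < d \<Longrightarrow> A $$ (i, j) = cnj (A $$ (j, i))"
    and near: "\<And>i j. i < d \<Longrightarrow> j < d \<Longrightarrow>
      cmod (A $$ (i, j) - (if i = j then complex_of_real c else 0)) \<le> c / d"
    and c: "c \<ge> 0"
  shows "psd_mat d A"
  unfolding psd_mat_def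
proof (intro conjI ballI A)
  fix v :: "complex vec" assume v: "v \<in> carrier_vec d"
  define H where "H = (\<lambda>i j. A $$ (i, j) - (if i = j then complex_of_real c else 0))"
  define Q where "Q = (\<Sum>i<d. \<Sum>j<d. A $$ (i, j) * v $ j * cnj (v $ i))"
  define P where "P = (\<Sum>i<d. \<Sum>j<d. H i j * v $ j * cnj (v $ i))"
  define N where "N = (\<Sum>i<d. (cmod (v $ i))\<^sup>2)"
  have "cnj Q = (\<Sum>i<d. \<Sum>j<d. A $$ (j, i) * v $ i * cnj (v $ j))"
    unfolding Q_def cnj_sum
  proof (intro sum.cong refl)
    fix i j assume "i \<in> {..<d}" "j \<in> {..<d}"
    then have "A $$ (i, j) = cnj (A $$ (j, i))" by (intro herm) auto
    then show "cnj (A $$ (i, j) * v $ j * cnj (v $ i)) = A $$ (j, i) * v $ i * cnj (v $ j)"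
      by simp
  qed
  also have "\<dots> = Q" unfolding Q_def by (rule sum.swap)
  finally have "Im Q = 0" by (simp add: complex_eq_iff)
  have "Q = (\<Sum>i<d. \<Sum>j<d. H i j * v $ j * cnj (v $ i)
      + (if j = i then complex_of_real c * v $ j * cnj (v $ i) else 0))"
    unfolding Q_def by (intro sum.cong refl) (auto simp: H_def algebra_simps)
  also have "\<dots> = P + (\<Sum>i<d. complex_of_real (c * (cmod (v $ i))\<^sup>2))"
    unfolding P_def
    by (simp add: sum.distrib mult.assoc flip: complex_norm_square)
  also have "\<dots> = P + complex_of_real (c * N)" by (simp add: N_def sum_distrib_left)
  finally have Q: "Re Q = Re P + c * N" by simp
  have "cmod P \<le> (\<Sum>i<d. \<Sum>j<d. c / d * (cmod (v $ j) * cmod (v $ i)))"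
    unfolding P_def
  proof (intro sum_norm_le)
    fix i j assume "i \<in> {..<d}" "j \<in> {..<d}"
    then have "cmod (H i j) \<le> c / d" using near by (simp add: H_def)
    then show "cmod (H i j * v $ j * cnj (v $ i)) \<le> c / d * (cmod (v $ j) * cmod (v $ i))"
      unfolding norm_mult complex_mod_cnj mult.assoc by (rule mult_right_mono) simp
  qed
  also have "\<dots> = c / d * (\<Sum>i<d. cmod (v $ i))\<^sup>2"
    by (simp add: power2_eq_square sum_product sum_distrib_left mult_ac)
  \<comment> \<open>Cauchy-Schwarz against the all-ones vector; its factor \<open>d\<close> cancels
    the one in the entry bound.\<close>
  also have "\<dots> \<le> c / d * (d * N)"
    using sum_squared_le_sum_of_squares[of "\<lambda>i. cmod (v $ i)" "{..<d}"] c
    by (intro mult_left_mono) (auto simp: N_def mult.commute)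
  also have "\<dots> \<le> c * N" by (cases "d = 0") (use c in \<open>auto simp: N_def\<close>)
  finally have "cmod P \<le> c * N" .
  then have "0 \<le> Re Q" using Q abs_Re_le_cmod[of P] by linarith
  then show "0 \<le> (A *\<^sub>v v) \<bullet>c v"
    using \<open>Im Q = 0\<close> cscalar_prod_mult_mat_vec[OF A v] by (simp add: less_eq_complex_def Q_def)
qed

section \<open>Real coordinates for Hermitian matrices\<close>

text \<open>
  The symmetric part of a real matrix becomes the real part and the antisymmetric part the imaginary
  part. This is an isometry from all real matrices onto the Hermitian ones, with inverse
  \<open>A \<mapsto> Re A + Im A\<close>.
\<close>

definition hermitian_of :: "nat \<Rightarrow> (nat \<times> nat \<Rightarrow> real) \<Rightarrow> complex mat" where
  "hermitian_of d r =
     mat d d (\<lambda>(i, j). Complex ((r (i, j) + r (j, i)) / 2) ((r (i, j) - r (j, i)) / 2))"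

text \<open>The coordinates of the identity matrix. Pairing with them yields the trace, so
  \<open>delta\<close> is the normal of the hyperplane containing the states.\<close>

definition delta :: "nat \<times> nat \<Rightarrow> real" where
  "delta = (\<lambda>(i, j). if i = j then 1 else 0)"

lemma delta_Pair [simp]: "delta (i, j) = (if i = j then 1 else 0)"
  by (simp add: delta_def)

lemma hermitian_of_carrier: "hermitian_of d r \<in> carrier_mat d d"
  by (simp add: hermitian_of_def)

lemma hermitian_of_index:
  "i < d \<Longrightarrow> j < d \<Longrightarrow> hermitian_of d r $$ (i, j) =
    Complex ((r (i, j) + r (j, i)) / 2) ((r (i, j) - r (j, i)) / 2)"
  by (simp add: hermitian_of_def)

lemma hermitian_of_Re_plus_Im:
  assumes "psd_mat d A"
  shows "hermitian_of d (\<lambda>k. Re (A $$ k) + Im (A $$ k)) = A"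
proof (rule eq_matI)
  have A: "A \<in> carrier_mat d d" using assms by (simp add: psd_mat_def)
  fix i j assume "i < dim_row A" "j < dim_col A"
  then have ij: "i < d" "j < d" using A by auto
  then have "A $$ (i, j) = cnj (A $$ (j, i))" by (intro psd_mat_hermitian[OF assms])
  then show "hermitian_of d (\<lambda>k. Re (A $$ k) + Im (A $$ k)) $$ (i, j) = A $$ (i, j)"
    using ij by (simp add: hermitian_of_index complex_eq_iff)
qed (use assms in \<open>auto simp: psd_mat_def hermitian_of_def\<close>)

lemma mat_trace_hermitian_of:
  "mat_trace (hermitian_of d r) = complex_of_real (\<Sum>k\<in>{..<d} \<times> {..<d}. r k * delta k)"
proof -
  have "(\<Sum>k\<in>{..<d} \<times> {..<d}. r k * delta k) = (\<Sum>i<d. \<Sum>j<d. r (i, j) * delta (i, j))"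
    by (simp only: sum.cartesian_product case_prod_unfold prod.collapse)
  also have "\<dots> = (\<Sum>i<d. r (i, i))"
    by (simp add: if_distrib[of "\<lambda>a. _ * a"] cong: if_cong)
  finally show ?thesis
    by (simp add: mat_trace_def hermitian_of_def complex_eq_iff)
qed

text \<open>The isometry property: it turns the measurement rule into a plain dot product. The mixed
  terms such as \<open>e (i, j) * r (j, i)\<close> cancel between the products of real parts and of
  imaginary parts.\<close>

lemma Re_mat_trace_hermitian_of_mult:
  "Re (mat_trace (hermitian_of d e * hermitian_of d r)) = (\<Sum>k\<in>{..<d} \<times> {..<d}. r k * e k)"
proof -
  have "mat_trace (hermitian_of d e * hermitian_of d r)
      = (\<Sum>i<d. \<Sum>j<d. hermitian_of d e $$ (i, j) * hermitian_of d r $$ (j, i))"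
    using hermitian_of_carrier[of d e] hermitian_of_carrier[of d r]
    by (auto simp: mat_trace_def scalar_prod_def lessThan_atLeast0 intro!: sum.cong)
  then have "Re (mat_trace (hermitian_of d e * hermitian_of d r))
      = (\<Sum>i<d. \<Sum>j<d. (r (i, j) * e (i, j) + r (j, i) * e (j, i)) / 2)"
    by (auto simp: hermitian_of_index field_simps intro!: sum.cong)
  also have "\<dots> = ((\<Sum>i<d. \<Sum>j<d. r (i, j) * e (i, j)) + (\<Sum>i<d. \<Sum>j<d. r (j, i) * e (j, i))) / 2"
    by (simp add: sum.distrib flip: sum_divide_distrib)
  also have "(\<Sum>i<d. \<Sum>j<d. r (j, i) * e (j, i)) = (\<Sum>i<d. \<Sum>j<d. r (i, j) * e (i, j))"
    by (rule sum.swap)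
  finally show ?thesis by (simp add: sum.cartesian_product)
qed

text \<open>The radius is half the entry bound \<open>c / d\<close>, because the errors of the real
  and the imaginary part add up.\<close>

lemma psd_mat_hermitian_of:
  assumes near: "\<And>k. k \<in> {..<d} \<times> {..<d} \<Longrightarrow> \<bar>r k - c * delta k\<bar> \<le> c / (2 * real d)" and c: "c \<ge> 0"
  shows "psd_mat d (hermitian_of d r)"
proof (rule psd_mat_near_scalar[where c = c])
  fix i j assume ij: "i < d" "j < d"
  show "hermitian_of d r $$ (i, j) = cnj (hermitian_of d r $$ (j, i))"
    using ij by (simp add: hermitian_of_index complex_eq_iff minus_divide_left)
  let ?z = "hermitian_of d r $$ (i, j) - (if i = j then complex_of_real c else 0)"
  have n: "\<bar>r (i, j) - c * delta (i, j)\<bar> \<le> c / (2 * real d)"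
    "\<bar>r (j, i) - c * delta (j, i)\<bar> \<le> c / (2 * real d)"
    using near[of "(i, j)"] near[of "(j, i)"] ij by auto
  have "\<bar>Re ?z\<bar> \<le> c / (2 * real d)" "\<bar>Im ?z\<bar> \<le> c / (2 * real d)"
    using n ij by (auto simp: hermitian_of_index split: if_splits)
  then have "\<bar>Re ?z\<bar> + \<bar>Im ?z\<bar> \<le> c / d" by (simp add: field_simps)
  then show "cmod ?z \<le> c / d" using cmod_le[of ?z] by linarith
qed (use c hermitian_of_carrier in auto)

section \<open>Quantum protocols as sign representations\<close>

text \<open>As in the classical case, with trace in place of total mass: subtracting half the
  identity from \<open>E y\<close> shifts the probability by 1/2, and the centre of contraction is
  the maximally mixed state.\<close>

lemma quantum_protocol_iff_sign_representation:
  assumes dom: "dom f \<subseteq> X \<times> Y" and fin: "finite X"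
  shows "(\<exists>\<rho> E. quantum_protocol n X Y \<rho> E \<and> computes_unbounded_error f (quantum_prob0 \<rho> E))
    \<longleftrightarrow> (\<exists>p q. sign_representation X f ({..<2 ^ n} \<times> {..<2 ^ n}) delta p q)" (is "?Q \<longleftrightarrow> ?R")
proof
  let ?I = "{..<2 ^ n} \<times> {..<2 ^ n} :: (nat \<times> nat) set"
  assume ?Q
  then obtain \<rho> E where qp: "quantum_protocol n X Y \<rho> E"
    and co: "computes_unbounded_error f (quantum_prob0 \<rho> E)" by blast
  define p where "p = (\<lambda>x k. Re (\<rho> x $$ k) + Im (\<rho> x $$ k))"
  define e where "e = (\<lambda>y k. Re (E y $$ k) + Im (E y $$ k))"
  have \<rho>: "hermitian_of (2 ^ n) (p x) = \<rho> x" "mat_trace (\<rho> x) = 1" if "x \<in> X" for x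
    using qp that
    by (auto simp: quantum_protocol_def qubit_state_def p_def intro: hermitian_of_Re_plus_Im)
  have E: "hermitian_of (2 ^ n) (e y) = E y" if "y \<in> Y" for y
    using qp that
    by (auto simp: quantum_protocol_def qubit_povm_def e_def intro: hermitian_of_Re_plus_Im)
  have one: "(\<Sum>k\<in>?I. p x k * delta k) = 1" if "x \<in> X" for x
  proof -
    have "complex_of_real (\<Sum>k\<in>?I. p x k * delta k) = 1"
      by (simp only: mat_trace_hermitian_of[symmetric] \<rho>[OF that])
    then show ?thesis by (simp only: of_real_eq_1_iff)
  qed
  have prob: "quantum_prob0 \<rho> E x y = (\<Sum>k\<in>?I. p x k * e y k)" if "x \<in> X" "y \<in> Y" for x y
    using Re_mat_trace_hermitian_of_mult[of "2 ^ n" "e y" "p x"] \<rho>(1)[OF that(1)] E[OF that(2)]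
    by (simp add: quantum_prob0_def)
  have "quantum_prob0 \<rho> E x y = 1 / 2 + (\<Sum>k\<in>?I. p x k * (e y k - delta k / 2))"
    if "x \<in> X" "y \<in> Y" for x y
  proof -
    have "(\<Sum>k\<in>?I. p x k * (e y k - delta k / 2))
        = (\<Sum>k\<in>?I. p x k * e y k) - (\<Sum>k\<in>?I. p x k * delta k) / 2"
      by (simp only: right_diff_distrib sum_subtractf sum_divide_distrib times_divide_eq_right)
    then show ?thesis using prob[OF that] one[OF that(1)] by simp
  qed
  then have "computes_unbounded_error f (\<lambda>x y. 1 / 2 + (\<Sum>k\<in>?I. p x k * (e y k - delta k / 2)))"
    by (intro computes_unbounded_error_sgn_cong[OF dom co]) simp
  then have "sign_representation X f ?I delta p (\<lambda>y k. e y k - delta k / 2)"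
    using one unfolding sign_representation_def by blast
  then show ?R by blast
next
  let ?I = "{..<2 ^ n} \<times> {..<2 ^ n} :: (nat \<times> nat) set"
  let ?d = "2 ^ n :: real"
  assume ?R
  then obtain p0 q0 where rep0: "sign_representation X f ?I delta p0 q0" by blast
  have "(\<Sum>k\<in>?I. delta k / ?d * delta k) =
      (\<Sum>i<2 ^ n. \<Sum>j<2 ^ n. delta (i, j) / ?d * delta (i, j))"
    by (simp only: sum.cartesian_product case_prod_unfold prod.collapse)
  also have "\<dots> = (\<Sum>i<2 ^ n :: nat. \<Sum>j<2 ^ n. if i = j then 1 / ?d else 0)"
    by (intro sum.cong refl) simp
  also have "\<dots> = 1" by simp
  finally have centre: "(\<Sum>k\<in>?I. delta k / ?d * delta k) = 1" .
  \<comment> \<open>With d the dimension, positivity near the mixed state allows deviation 1/(2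
    d^2), and near half the identity 1/(4 d). As d is at least 1, the radius 1/(4 d^2) meets
    both.\<close>
  obtain p q where rep: "sign_representation X f ?I delta p q"
    and p: "\<And>x k. x \<in> X \<Longrightarrow> k \<in> ?I \<Longrightarrow> \<bar>p x k - delta k / ?d\<bar> \<le> 1 / (4 * ?d ^ 2)"
    and q: "\<And>y k. k \<in> ?I \<Longrightarrow> \<bar>q y k\<bar> \<le> 1 / (4 * ?d ^ 2)"
    by (rule sign_representation_near[OF rep0 dom fin _ centre, of "1 / (4 * ?d ^ 2)"]) auto
  define \<rho> where "\<rho> = (\<lambda>x. hermitian_of (2 ^ n) (p x))"
  define E where "E = (\<lambda>y. hermitian_of (2 ^ n) (\<lambda>k. q y k + delta k / 2))"
  have one: "(\<Sum>k\<in>?I. p x k * delta k) = 1" if "x \<in> X" for x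
    using rep that unfolding sign_representation_def by blast
  have d1: "1 / (4 * ?d ^ 2) \<le> 1 / ?d / (2 * ?d)" by (simp add: power2_eq_square field_simps)
  have d2: "1 / (4 * ?d ^ 2) \<le> 1 / 2 / (2 * ?d)" by (simp add: power2_eq_square field_simps)
  have "qubit_state n (\<rho> x)" if "x \<in> X" for x
  proof -
    have "psd_mat (2 ^ n) (\<rho> x)"
      unfolding \<rho>_def
    proof (rule psd_mat_hermitian_of[where c = "1 / ?d"])
      show "\<bar>p x k - 1 / ?d * delta k\<bar> \<le> 1 / ?d / (2 * real (2 ^ n))" if "k \<in> ?I" for k
        using p[OF \<open>x \<in> X\<close> that] d1 by simp
    qed simp
    then show ?thesis
      using one[OF that] mat_trace_hermitian_of[of "2 ^ n" "p x"]
      by (simp only: qubit_state_def \<rho>_def of_real_1 simp_thms)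
  qed
  moreover have "qubit_povm n (E y)" for y
  proof -
    have "psd_mat (2 ^ n) (E y)"
      unfolding E_def
    proof (rule psd_mat_hermitian_of[where c = "1 / 2"])
      show "\<bar>q y k + delta k / 2 - 1 / 2 * delta k\<bar> \<le> 1 / 2 / (2 * real (2 ^ n))"
        if "k \<in> ?I" for k
        using q[OF that, of y] d2 by simp
    qed simp
    \<comment> \<open>The complement reflects \<open>E y\<close> about half the identity, so the
      same bound on \<open>q\<close> makes it positive.\<close>
    moreover have "1\<^sub>m (2 ^ n) - E y = hermitian_of (2 ^ n) (\<lambda>k. delta k / 2 - q y k)"
      by (rule eq_matI) (auto simp: E_def hermitian_of_def complex_eq_iff field_simps)
    moreover have "psd_mat (2 ^ n) (hermitian_of (2 ^ n) (\<lambda>k. delta k / 2 - q y k))"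
    proof (rule psd_mat_hermitian_of[where c = "1 / 2"])
      show "\<bar>delta k / 2 - q y k - 1 / 2 * delta k\<bar> \<le> 1 / 2 / (2 * real (2 ^ n))"
        if "k \<in> ?I" for k
        using q[OF that, of y] d2 by simp
    qed simp
    ultimately show ?thesis by (simp add: qubit_povm_def)
  qed
  moreover have "computes_unbounded_error f (quantum_prob0 \<rho> E)"
  proof (rule computes_unbounded_error_sgn_cong[OF dom])
    show "computes_unbounded_error f (\<lambda>x y. 1 / 2 + (\<Sum>k\<in>?I. p x k * q y k))"
      using rep unfolding sign_representation_def by blast
    fix x y assume "x \<in> X"
    have "quantum_prob0 \<rho> E x y = (\<Sum>k\<in>?I. p x k * (q y k + delta k / 2))"
      unfolding quantum_prob0_def \<rho>_def E_def by (rule Re_mat_trace_hermitian_of_mult)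
    also have "\<dots> = (\<Sum>k\<in>?I. p x k * q y k) + (\<Sum>k\<in>?I. p x k * delta k) / 2"
      by (simp only: distrib_left sum.distrib sum_divide_distrib times_divide_eq_right)
    finally show "sgn (1 / 2 + (\<Sum>k\<in>?I. p x k * q y k) - 1 / 2)
        = sgn (quantum_prob0 \<rho> E x y - 1 / 2)"
      using one[OF \<open>x \<in> X\<close>] by simp
  qed
  ultimately show ?Q unfolding quantum_protocol_def by blast
qed

section \<open>Comparison of dimensions\<close>

text \<open>An upward closed property is a threshold \<open>C \<le> n\<close>, and the least
  \<open>n\<close> with \<open>C \<le> 2 * n\<close> is \<open>C / 2\<close> rounded up.\<close>

lemma Least_double_eq_ceiling_half:
  assumes "P m" and mono: "\<And>i j. i \<le> j \<Longrightarrow> P i \<Longrightarrow> P j"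
  shows "int (LEAST n. P (2 * n)) = \<lceil>real (LEAST n. P n) / 2\<rceil>"
proof -
  define C where "C = (LEAST n. P n)"
  have P: "P n \<longleftrightarrow> C \<le> n" for n
    using Least_le[of P n] LeastI[of P m] assms unfolding C_def by blast
  have "(LEAST n. P (2 * n)) = (C + 1) div 2"
    by (rule Least_equality) (auto simp: P)
  moreover have "\<lceil>real C / 2\<rceil> = int ((C + 1) div 2)"
    by (cases "even C") (auto elim!: evenE oddE intro!: ceiling_unique)
  ultimately show ?thesis by (simp add: C_def)
qed

theorem theorem4p2:
  fixes X :: "'a set" and Y :: "'b set" and f :: "'a \<times> 'b \<Rightarrow> bool option"
  assumes "finite X" and "X \<noteq> {}" and "finite Y" and "Y \<noteq> {}"
    and "dom f \<subseteq> X \<times> Y"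
  shows "int (quantum_complexity X Y f) = \<lceil>real (classical_complexity X Y f) / 2\<rceil>"
proof -
  define P where "P = (\<lambda>n. \<exists>p q. sign_representation X f (messages n) (\<lambda>_. 1) p q)"
  note mono = sign_representation_mono[OF _ assms(5)]
  \<comment> \<open>Both index sets have \<open>2 ^ (2 * n)\<close> elements, so the transfer works
    in either direction. Its distinguished indices are a diagonal position, where
    \<open>delta\<close> is 1, and any message.\<close>
  have "(\<exists>p q. sign_representation X f ({..<2 ^ n} \<times> {..<2 ^ n}) delta p q) \<longleftrightarrow> P (2 * n)" for n
  proof
    assume "\<exists>p q. sign_representation X f ({..<2 ^ n} \<times> {..<2 ^ n}) delta p q"
    then show "P (2 * n)"
      unfolding P_def
      by (elim exE)
        (rule mono[where a = "(0, 0)" and b = "replicate (2 * n) True"],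
          auto simp: finite_messages card_messages messages_nonempty power_add mult_2)
  next
    assume "P (2 * n)"
    then show "\<exists>p q. sign_representation X f ({..<2 ^ n} \<times> {..<2 ^ n}) delta p q"
      unfolding P_def
      by (elim exE)
        (rule mono[where b = "(0, 0)" and a = "replicate (2 * n) True"],
          auto simp: finite_messages card_messages messages_nonempty power_add mult_2)
  qed
  then have Q: "quantum_complexity X Y f = (LEAST n. P (2 * n))"
    unfolding quantum_complexity_def
    by (simp add: quantum_protocol_iff_sign_representation[OF assms(5,1)])
  have C: "classical_complexity X Y f = (LEAST n. P n)"
    unfolding classical_complexity_def P_def
    by (simp add: classical_protocol_iff_sign_representation[OF assms(5,1)])
  obtain x where "x \<in> X" using assms(2) by blast
  \<comment> \<open>The indicator representation fits because \<open>card X\<close> is below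
    \<open>2 ^ card X\<close>; this starts the threshold argument.\<close>
  have "P (card X)"
    unfolding P_def
    by (rule mono[OF sign_representation_indicator[OF assms(1,5)],
          where a = x and b = "replicate (card X) True"])
      (use assms(1) \<open>x \<in> X\<close> in \<open>auto simp: finite_messages card_messages messages_nonempty
          less_imp_le\<close>)
  moreover have "P j" if "i \<le> j" "P i" for i j
    using that unfolding P_def
    by (elim exE)
      (rule mono[where a = "replicate i True" and b = "replicate j True"],
        auto simp: finite_messages card_messages messages_nonempty)
  ultimately show ?thesis unfolding Q C by (rule Least_double_eq_ceiling_half)
qed

end
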